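(* Let $\mathcal{H}$ be a complex Hilbert space and let $L,M$ be closed linear subspaces of $\mathcal{H}$ such that, with $Q=L\cap M$, both $L\ominus Q$ and $M\ominus Q$ are non-zero. Suppose there are constants $A_1,A_2<\infty$ such that every $x\in\mathcal{H}$ can be represented as $x=x^L+x^M$ with $x^L\in L$, $x^M\in M$, $\|x^L\|\le A_1\|x\|$ and $\|x^M\|\le A_2\|x\|$. Then 1. $c(L,M)<1$; 2. $(L+M)^\perp=\{0\}$.
   Context: For closed subspaces $L,M$ of a Hilbert space $\mathcal{H}$ with $Q=L\cap M$, $L\ominus Q$ and $M\ominus Q$ denote the orthogonal complements of $Q$ in $L$ and in $M$ respectively. The case $Q=\{0\}$ is allowed; it is assumed that $L\ominus Q\neq\{0\}$ and $M\ominus Q\ne\{0\}$. The inclination of $L$ and $M$ is $$c(L,M)=\sup\left\{\frac{|(u,v)|}{\|u\|\,\|v\|} : 0\ne u\in L\ominus Q,\ 0\neq v\in M\ominus Q\right\}\in[0,1].$$ The sum is $L+M=\{x\in\mathcal{H}: x=x^L+x^M,\ x^L\in L,\ x^M\in M\}$, and $(L+M)^\perp$ is its orthogonal complement in $\mathcal{H}$. *)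

theory Defs
  imports "HOL-Analysis.Analysis"
begin

class complex_vector = real_vector +
  fixes scaleC :: "complex \<Rightarrow> 'a \<Rightarrow> 'a"
  assumes scaleC_add_right: "scaleC a (x + y) = scaleC a x + scaleC a y"
    and scaleC_add_left: "scaleC (a + b) x = scaleC a x + scaleC b x"
    and scaleC_scaleC: "scaleC a (scaleC b x) = scaleC (a * b) x"
    and scaleC_one: "scaleC 1 x = x"
    and scaleR_scaleC: "scaleR r x = scaleC (complex_of_real r) x"

global_interpretation complex_vector:
    vector_space "scaleC :: complex \<Rightarrow> 'a \<Rightarrow> 'a::complex_vector"
  by unfold_locales (simp_all add: scaleC_add_right scaleC_add_left scaleC_scaleC scaleC_one)

text \<open>The inner product is linear in its first argument. The superclass
  \<^class>\<open>real_normed_vector\<close> supplies the library's norm, metric and topology;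
  \<open>norm_eq_sqrt_cinner\<close> forces these to be the ones induced by the inner product.\<close>

class complex_inner = complex_vector + real_normed_vector +
  fixes cinner :: "'a \<Rightarrow> 'a \<Rightarrow> complex"
  assumes cinner_add_left: "cinner (x + y) z = cinner x z + cinner y z"
    and cinner_scaleC_left: "cinner (scaleC a x) y = a * cinner x y"
    and cinner_commute: "cinner x y = cnj (cinner y x)"
    and cinner_self_nonneg: "0 \<le> Re (cinner x x)"
    and cinner_self_eq_0: "cinner x x = 0 \<longleftrightarrow> x = 0"
    and norm_eq_sqrt_cinner: "norm x = sqrt (Re (cinner x x))"

class complex_hilbert = complex_inner + complete_space

instantiation complex :: complex_hilbert
begin

definition scaleC_complex :: "complex \<Rightarrow> complex \<Rightarrow> complex"
  where "scaleC_complex a x = a * x"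

definition cinner_complex :: "complex \<Rightarrow> complex \<Rightarrow> complex"
  where "cinner_complex x y = x * cnj y"

instance
  by standard
    (auto simp: scaleC_complex_def cinner_complex_def algebra_simps scaleR_conv_of_real
      cmod_def power2_eq_square)

end

definition closed_csubspace :: "'a::complex_inner set \<Rightarrow> bool"
  where "closed_csubspace L \<longleftrightarrow> complex_vector.subspace L \<and> closed L"

definition orth_compl :: "'a::complex_inner set \<Rightarrow> 'a set"
  where "orth_compl S = {x. \<forall>y\<in>S. cinner x y = 0}"

definition orth_diff :: "'a::complex_inner set \<Rightarrow> 'a set \<Rightarrow> 'a set"  (infixl \<open>\<ominus>\<^sub>H\<close> 65)
  where "L \<ominus>\<^sub>H Q = L \<inter> orth_compl Q"

text \<open>The supremum is taken in the reals. By Cauchy--Schwarz the set is bounded above by 1;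
  it is nonempty exactly when both orthogonal differences contain a nonzero vector, and
  outside that case the value is not meaningful.\<close>

definition inclination :: "'a::complex_inner set \<Rightarrow> 'a set \<Rightarrow> real"
  where "inclination L M =
    Sup {cmod (cinner u v) / (norm u * norm v) | u v.
           u \<in> L \<ominus>\<^sub>H (L \<inter> M) \<and> u \<noteq> 0 \<and> v \<in> M \<ominus>\<^sub>H (L \<inter> M) \<and> v \<noteq> 0}"

end

(* For u in L orthogonal to Q and v in M orthogonal to Q, let x be the component of u orthogonal
   to v, so that |x|^2 = |u|^2 - |(u,v)|^2 / |v|^2.  Decomposing x = xL + xM, the vector u - xL
   lies in L and in M, hence in Q, so it is orthogonal to u and |u| <= |xL| <= A1 |x|.  This
   bounds |(u,v)| / (|u| |v|) by sqrt (1 - 1 / A1^2). *)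
theory Submission
  imports Defs
begin

lemma cinner_zero_left: "cinner 0 y = 0" for y :: "'a::complex_inner"
  using cinner_add_left[of 0 0 y] by simp

lemma cinner_diff_left: "cinner (x - y) z = cinner x z - cinner y z"
  for x :: "'a::complex_inner"
  using cinner_add_left[of "x - y" y z] by simp

lemma cinner_diff_right: "cinner z (x - y) = cinner z x - cinner z y"
  for x :: "'a::complex_inner"
  by (metis cinner_commute cinner_diff_left complex_cnj_diff)

lemma cinner_scaleC_right: "cinner x (scaleC a y) = cnj a * cinner x y"
  for x :: "'a::complex_inner"
  by (metis cinner_commute cinner_scaleC_left complex_cnj_mult)

lemma cinner_self: "cinner x x = complex_of_real ((norm x)\<^sup>2)" for x :: "'a::complex_inner"
proof -
  have "Im (cinner x x) = 0"
    using arg_cong[OF cinner_commute[of x x], of Im] by simp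
  then show ?thesis
    by (simp add: complex_eq_iff norm_eq_sqrt_cinner cinner_self_nonneg)
qed

text \<open>Pythagoras: the cross terms vanish, so subtracting an orthogonal vector can only
  lengthen \<open>u\<close>. It is applied with \<open>q = u - xL\<close>, where
  \<open>u - q\<close> collapses to \<open>xL\<close>.\<close>

lemma norm_le_norm_diff_orthogonal:
  fixes u q :: "'a::complex_inner"
  assumes "cinner u q = 0"
  shows "norm u \<le> norm (u - q)"
proof -
  have "cinner q u = 0"
    using assms by (metis cinner_commute complex_cnj_zero)
  \<comment> \<open>The identity is lifted to the complex numbers, where squared norms turn into
    inner products that expand by sesquilinearity.\<close>
  then have "complex_of_real ((norm (u - q))\<^sup>2) = complex_of_real ((norm u)\<^sup>2 + (norm q)\<^sup>2)"
    using assms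
    by (simp only: of_real_add cinner_self[symmetric] cinner_diff_left cinner_diff_right
        diff_zero diff_0 diff_minus_eq_add)
  then have "(norm (u - q))\<^sup>2 = (norm u)\<^sup>2 + (norm q)\<^sup>2"
    by (simp only: of_real_eq_iff)
  then show ?thesis
    by (simp add: power2_le_imp_le)
qed

text \<open>The residual of projecting \<open>u\<close> onto the line through \<open>v\<close> is
  orthogonal to \<open>v\<close>, so its inner product with itself equals its inner product with
  \<open>u\<close>.\<close>

lemma norm_diff_projection_square:
  fixes u v :: "'a::complex_inner"
  assumes "v \<noteq> 0"
  shows "(norm (u - scaleC (cinner u v / cinner v v) v))\<^sup>2
    = (norm u)\<^sup>2 - (cmod (cinner u v))\<^sup>2 / (norm v)\<^sup>2"
proof -
  define k where "k = cinner u v / cinner v v"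
  define x where "x = u - scaleC k v"
  have "cinner v v \<noteq> 0"
    using assms cinner_self_eq_0 by blast
  then have "cinner x v = 0"
    by (simp add: x_def k_def cinner_diff_left cinner_scaleC_left)
  then have "cinner x x = cinner x u"
    by (simp add: x_def cinner_diff_right cinner_scaleC_right)
  also have "\<dots> = cinner u u - k * cnj (cinner u v)"
    by (simp add: x_def cinner_diff_left cinner_scaleC_left flip: cinner_commute)
  also have "\<dots> = complex_of_real ((norm u)\<^sup>2 - (cmod (cinner u v))\<^sup>2 / (norm v)\<^sup>2)"
    by (simp add: k_def cinner_self complex_norm_square[unfolded of_real_power, symmetric])
  finally show ?thesis
    unfolding cinner_self of_real_eq_iff x_def k_def .
qed

lemma zero_in_orth_compl: "0 \<in> orth_compl S"
  by (simp add: orth_compl_def cinner_zero_left)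

text \<open>Zero always lies in \<open>L \<ominus>\<^sub>H Q\<close>, so this set can differ from
  \<open>{0}\<close> only by having a nonzero element.\<close>

lemma orth_diff_obtain_nonzero:
  assumes "closed_csubspace L" "L \<ominus>\<^sub>H Q \<noteq> {0}"
  obtains u where "u \<in> L \<ominus>\<^sub>H Q" "u \<noteq> 0"
proof -
  have "0 \<in> L \<ominus>\<^sub>H Q"
    using assms(1) zero_in_orth_compl
    by (auto simp: closed_csubspace_def orth_diff_def complex_vector.subspace_0)
  with assms(2) that show thesis
    by blast
qed

lemma inclination_less_1:
  fixes L M :: "'a::complex_inner set"
  assumes L: "closed_csubspace L" and M: "closed_csubspace M"
    and "L \<ominus>\<^sub>H (L \<inter> M) \<noteq> {0}" and "M \<ominus>\<^sub>H (L \<inter> M) \<noteq> {0}"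
    and decomp: "\<And>x. \<exists>xL\<in>L. \<exists>xM\<in>M. x = xL + xM \<and> norm xL \<le> A * norm x"
  shows "inclination L M < 1"
proof -
  have subL: "complex_vector.subspace L" and subM: "complex_vector.subspace M"
    using L M by (simp_all add: closed_csubspace_def)
  \<comment> \<open>The scalar \<open>k\<close> stays free: \<open>k = 0\<close> will show that
    \<open>A\<close> is positive, and the projection coefficient will give the bound on the
    quotients.\<close>
  have norm_le: "norm u \<le> A * norm (u - scaleC k v)"
    if u: "u \<in> L \<ominus>\<^sub>H (L \<inter> M)" and v: "v \<in> M" for u v k
  proof -
    obtain xL xM where x: "xL \<in> L" "xM \<in> M" "u - scaleC k v = xL + xM"
        "norm xL \<le> A * norm (u - scaleC k v)"
      using decomp by blast
    have "u - xL \<in> L"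
      using u x(1) subL by (auto simp: orth_diff_def intro: complex_vector.subspace_diff)
    \<comment> \<open>The same vector, read from the side of \<open>M\<close>; lying in both
      subspaces, it is orthogonal to \<open>u\<close>.\<close>
    moreover have "u - xL = xM + scaleC k v"
      using x(3) by (simp add: algebra_simps)
    then have "u - xL \<in> M"
      using x(2) v subM
      by (simp add: complex_vector.subspace_add complex_vector.subspace_scale)
    ultimately have "cinner u (u - xL) = 0"
      using u by (simp add: orth_diff_def orth_compl_def)
    from norm_le_norm_diff_orthogonal[OF this] x(4) show ?thesis
      by simp
  qed
  obtain u0 where u0: "u0 \<in> L \<ominus>\<^sub>H (L \<inter> M)" "u0 \<noteq> 0"
    using orth_diff_obtain_nonzero[OF L assms(3)] .
  obtain v0 where v0: "v0 \<in> M \<ominus>\<^sub>H (L \<inter> M)" "v0 \<noteq> 0"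
    using orth_diff_obtain_nonzero[OF M assms(4)] .
  \<comment> \<open>With \<open>k = 0\<close> the estimate reads
    \<open>norm u0 \<le> A * norm u0\<close>. The sign of \<open>A\<close> is not assumed, and
    \<open>1 / A\<^sup>2\<close> requires \<open>A\<close> to be nonzero.\<close>
  have "0 < A * norm (u0 - scaleC 0 v0)"
    using norm_le[of u0 v0 0] u0 v0 by (auto simp: orth_diff_def intro: less_le_trans)
  then have A: "A > 0"
    by (simp add: zero_less_mult_iff)
  have ratio_le: "cmod (cinner u v) / (norm u * norm v) \<le> sqrt (1 - 1 / A\<^sup>2)"
    if u: "u \<in> L \<ominus>\<^sub>H (L \<inter> M)" "u \<noteq> 0" and v: "v \<in> M \<ominus>\<^sub>H (L \<inter> M)" "v \<noteq> 0" for u v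
  proof (rule real_le_rsqrt)
    have "norm u \<le> A * norm (u - scaleC (cinner u v / cinner v v) v)"
      using norm_le u v by (simp add: orth_diff_def)
    then have "(norm u)\<^sup>2 \<le> (A * norm (u - scaleC (cinner u v / cinner v v) v))\<^sup>2"
      by (intro power_mono) auto
    also have "\<dots> = A\<^sup>2 * ((norm u)\<^sup>2 - (cmod (cinner u v))\<^sup>2 / (norm v)\<^sup>2)"
      by (simp add: power_mult_distrib norm_diff_projection_square v)
    \<comment> \<open>Pulling out \<open>(norm u)\<^sup>2\<close> exposes the squared quotient; the
      positive factor then cancels.\<close>
    also have "\<dots> = A\<^sup>2 * (norm u)\<^sup>2 * (1 - (cmod (cinner u v) / (norm u * norm v))\<^sup>2)"
      using u(2) by (simp add: field_simps)
    finally have "(norm u)\<^sup>2 * 1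
        \<le> (norm u)\<^sup>2 * (A\<^sup>2 * (1 - (cmod (cinner u v) / (norm u * norm v))\<^sup>2))"
      by (simp only: ac_simps mult_1_right)
    then have "1 \<le> A\<^sup>2 * (1 - (cmod (cinner u v) / (norm u * norm v))\<^sup>2)"
      using u(2) by (subst (asm) mult_le_cancel_left_pos) auto
    then have "1 / A\<^sup>2 \<le> 1 - (cmod (cinner u v) / (norm u * norm v))\<^sup>2"
      using A by (subst pos_divide_le_eq) (simp_all add: mult.commute)
    then show "(cmod (cinner u v) / (norm u * norm v))\<^sup>2 \<le> 1 - 1 / A\<^sup>2"
      by simp
  qed
  \<comment> \<open>The bound does not depend on \<open>u\<close> and \<open>v\<close>, so it passes
    to the supremum and stays strictly below 1. The pair \<open>u0\<close>, \<open>v0\<close> shows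
    that the supremum is over a nonempty set.\<close>
  have "inclination L M \<le> sqrt (1 - 1 / A\<^sup>2)"
    unfolding inclination_def
  proof (rule cSup_least)
    show "{cmod (cinner u v) / (norm u * norm v) | u v.
        u \<in> L \<ominus>\<^sub>H (L \<inter> M) \<and> u \<noteq> 0 \<and> v \<in> M \<ominus>\<^sub>H (L \<inter> M) \<and> v \<noteq> 0} \<noteq> {}"
      using u0 v0 by blast
  qed (use ratio_le in blast)
  also have "\<dots> < 1"
    using A by simp
  finally show ?thesis .
qed

text \<open>The sum is the whole space, so a vector orthogonal to it is orthogonal to
  itself.\<close>

lemma orth_compl_eq_0_if_sum_UNIV:
  fixes L M :: "'a::complex_inner set"
  assumes "\<And>x. \<exists>xL\<in>L. \<exists>xM\<in>M. x = xL + xM"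
  shows "orth_compl (L + M) = {0}"
proof -
  have "x = 0" if "x \<in> orth_compl (L + M)" for x
  proof -
    have "x \<in> L + M"
      using assms[of x] by (auto intro: set_plus_intro)
    then have "cinner x x = 0"
      using that by (simp add: orth_compl_def)
    then show ?thesis
      by (simp add: cinner_self_eq_0)
  qed
  then show ?thesis
    using zero_in_orth_compl by blast
qed

theorem mainTheorem3:
  fixes L M :: "'a::complex_hilbert set" and A1 A2 :: real
  assumes "closed_csubspace L" and "closed_csubspace M"
    and "L \<ominus>\<^sub>H (L \<inter> M) \<noteq> {0}" and "M \<ominus>\<^sub>H (L \<inter> M) \<noteq> {0}"
    and "\<forall>x::'a. \<exists>xL\<in>L. \<exists>xM\<in>M. x = xL + xM \<and>
           norm xL \<le> A1 * norm x \<and> norm xM \<le> A2 * norm x"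
  shows "inclination L M < 1 \<and> orth_compl (L + M) = {0}"
proof
  show "inclination L M < 1"
    using assms(5) by (intro inclination_less_1[OF assms(1-4), where A = A1]) blast
  show "orth_compl (L + M) = {0}"
    using assms(5) by (intro orth_compl_eq_0_if_sum_UNIV) blast
qed

end
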